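(* There is an absolute constant $c>0$ such that for every positive integer $m$ and every partial Boolean function $g\subseteq\{0,1\}^m\times\{0,1\}$ with $g^{-1}(0)\neq\emptyset$ and $g^{-1}(1)\neq\emptyset$, \[\chi(g)\;\ge\; c\sqrt{\mathrm{R}_{1/3}(g)}.\]
   Context: A partial Boolean function is a relation $g\subseteq\{0,1\}^m\times\{0,1\}$. For $b\in\{0,1\}$, $g^{-1}(b)$ is the set of $x\in\{0,1\}^m$ with $(x,b)\in g$ and $(x,1-b)\notin g$; every string outside $g^{-1}(0)\cup g^{-1}(1)$ is related by $g$ to both $0$ and $1$. $\mathrm{R}_{1/3}(g)$ is the minimum worst-case number of queries of a randomized query algorithm that, on every input $x\in\{0,1\}^m$, outputs with probability at least $2/3$ a bit $b$ with $(x,b)\in g$. A (deterministic) decision tree on $(\{0,1\}^m)^n$ is a rooted binary tree in which each internal vertex queries some input bit $x_i^{(j)}$ ($x=(x_1,\dots,x_n)$, $x_i=(x_i^{(1)},\dots,x_i^{(m)})\in\{0,1\}^m$) and has children $v_0,v_1$ corresponding to query outcomes $0,1$. Each vertex $v$ is identified with the subcube of inputs whose computation reaches $v$; write $v=\times_{i=1}^n v^{(i)}$ with $v^{(i)}\subseteq\{0,1\}^m$. For $n=1$, a decision tree $\mathcal{B}$ computes $g$ if its leaves are labelled by bits and for every valid input $x$ the label of the leaf reached equals the unique $b$ with $x\in g^{-1}(b)$. Process $\mathcal{P}$ on $(\mathcal{B},\mu_0,\mu_1,z)$, where $\mathcal{B}$ is a decision tree on $(\{0,1\}^m)^n$, $\mu_0,\mu_1$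 are probability distributions on $\{0,1\}^m$ and $z\in\{0,1\}^n$: initialize $\mathsf{NQ}_k\gets1$ and $\mathsf{N}_k\gets0$ for all $k$, and $v\gets$ root. While $v$ is not a leaf, let $x_i^{(j)}$ be the bit queried at $v$ and, for $b\in\{0,1\}$, let $p_b=\Pr_{y\sim\mu_b}[y^{(j)}=0\mid y\in v^{(i)}]$. If $\mathsf{NQ}_i=1$: sample a fresh uniform real $r\in[0,1]$; if $r\le\min_b p_b$ set $v\gets v_0$; else if $r\ge\max_b p_b$ set $v\gets v_1$; otherwise set $\mathsf{NQ}_i\gets0$ and set $v\gets v_0$ if $r\le p_{z_i}$ and $v\gets v_1$ otherwise; in all three cases then set $\mathsf{N}_i\gets\mathsf{N}_i+1$. If $\mathsf{NQ}_i=0$: sample $y\sim\mu_{z_i}$ conditioned on $y\in v^{(i)}$ and set $v\gets v_{y^{(j)}}$. Conflict complexity: let $\mu_0,\mu_1$ be distributions supported on $g^{-1}(0)$ and $g^{-1}(1)$ respectively, and $\mathcal{B}$ a decision tree on $\{0,1\}^m$ (i.e. $n=1$) computing $g$. Run $\mathcal{P}$ on $(\mathcal{B},\mu_0,\mu_1,z)$ with $z\in\{0,1\}$ and let $\mathcal{N}$ be the final value of $\mathsf{N}_1$ (its distribution does not depend on $z$). Define $\chi(\mu_0,\mu_1,\mathcal{B})=\mathbb{E}[\mathcal{N}]$ and \[\chi(g)=\max_{\mu_0,\mu_1}\ \min_{\mathcal{B}}\ \chi(\mu_0,\mu_1,\mathcal{B}),\] the maximum over pairs of distributions supported on $g^{-1}(0)$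 and $g^{-1}(1)$ respectively, the minimum over decision trees computing $g$. *)

theory Defs
  imports "HOL-Probability.Probability"
begin

text \<open>Inputs in {0,1}^m are boolean lists of length m (False = 0, True = 1);
  bit j (0-based) of y is y ! j.\<close>

definition cube :: "nat \<Rightarrow> bool list set" where
  "cube m = {x. length x = m}"

text \<open>A partial Boolean function on {0,1}^m: a relation g \<subseteq> {0,1}^m \<times> {0,1}
  in which every string is related to at least one bit (strings outside
  g^{-1}(0) \<union> g^{-1}(1) are related to both bits).\<close>

definition partial_fn :: "nat \<Rightarrow> (bool list \<times> bool) set \<Rightarrow> bool" where
  "partial_fn m g \<longleftrightarrow> g \<subseteq> cube m \<times> UNIV \<and> (\<forall>x \<in> cube m. \<exists>b. (x, b) \<in> g)"

definition preimg :: "(bool list \<times> bool) set \<Rightarrow> bool \<Rightarrow> bool list set" where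
  "preimg g b = {x. (x, b) \<in> g \<and> (x, \<not> b) \<notin> g}"

datatype dtree = Leaf bool | Node nat dtree dtree

primrec valid_tree :: "nat \<Rightarrow> dtree \<Rightarrow> bool" where
  "valid_tree m (Leaf b) = True"
| "valid_tree m (Node j t0 t1) = (j < m \<and> valid_tree m t0 \<and> valid_tree m t1)"

primrec eval_tree :: "dtree \<Rightarrow> bool list \<Rightarrow> bool" where
  "eval_tree (Leaf b) x = b"
| "eval_tree (Node j t0 t1) x = (if x ! j then eval_tree t1 x else eval_tree t0 x)"

primrec num_queries :: "dtree \<Rightarrow> bool list \<Rightarrow> nat" where
  "num_queries (Leaf b) x = 0"
| "num_queries (Node j t0 t1) x = Suc (if x ! j then num_queries t1 x else num_queries t0 x)"

definition rand_query_cplx :: "nat \<Rightarrow> (bool list \<times> bool) set \<Rightarrow> nat" where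
  "rand_query_cplx m g = (LEAST d. \<exists>P :: dtree pmf.
      (\<forall>t \<in> set_pmf P. valid_tree m t \<and> (\<forall>x \<in> cube m. num_queries t x \<le> d)) \<and>
      (\<forall>x \<in> cube m. measure_pmf.prob P {t. (x, eval_tree t x) \<in> g} \<ge> 2/3))"

definition computes :: "nat \<Rightarrow> (bool list \<times> bool) set \<Rightarrow> dtree \<Rightarrow> bool" where
  "computes m g t \<longleftrightarrow> valid_tree m t \<and>
     (\<forall>b. \<forall>x \<in> preimg g b. eval_tree t x = b)"

text \<open>p_b = Pr_{y ~ mu_b}[ y^(j) = 0 | y \<in> S ]  (with the convention x/0 = 0).\<close>

definition cprob :: "bool list pmf \<Rightarrow> nat \<Rightarrow> bool list set \<Rightarrow> real" where
  "cprob \<mu> j S = measure_pmf.prob \<mu> (S \<inter> {y. y ! j = False}) / measure_pmf.prob \<mu> S"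

text \<open>Process P for n = 1.  proc mu z t S nq n is the distribution of the final
  value of N when the process is at vertex t with subcube S, flag NQ = nq and
  current counter N = n.  mu False = mu_0, mu True = mu_1.\<close>

primrec proc :: "(bool \<Rightarrow> bool list pmf) \<Rightarrow> bool \<Rightarrow> dtree \<Rightarrow> bool list set \<Rightarrow> bool \<Rightarrow> nat \<Rightarrow> nat measure" where
  "proc \<mu> z (Leaf b) S nq n = return (count_space UNIV) n"
| "proc \<mu> z (Node j t0 t1) S nq n =
     (let S0 = S \<inter> {y. y ! j = False}; S1 = S \<inter> {y. y ! j = True};
          p0 = cprob (\<mu> False) j S; p1 = cprob (\<mu> True) j S;
          pz = cprob (\<mu> z) j S in
      if nq then
        bind (uniform_measure lborel {0..1::real}) (\<lambda>r.
          if r \<le> min p0 p1 then proc \<mu> z t0 S0 True (Suc n)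
          else if r \<ge> max p0 p1 then proc \<mu> z t1 S1 True (Suc n)
          else if r \<le> pz then proc \<mu> z t0 S0 False (Suc n)
          else proc \<mu> z t1 S1 False (Suc n))
      else
        bind (measure_pmf (cond_pmf (\<mu> z) S)) (\<lambda>y.
          if y ! j then proc \<mu> z t1 S1 False n else proc \<mu> z t0 S0 False n))"

text \<open>chi(mu_0, mu_1, B) = E[N], N the final counter when P is started at the
  root (subcube {0,1}^m, NQ = 1, N = 0); we run it with z = 0 (the distribution
  of N does not depend on z).\<close>

definition chi_val :: "nat \<Rightarrow> (bool \<Rightarrow> bool list pmf) \<Rightarrow> dtree \<Rightarrow> ennreal" where
  "chi_val m \<mu> t = (\<integral>\<^sup>+ n. ennreal (real n) \<partial>(proc \<mu> False t (cube m) True 0))"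

definition conflict_cplx :: "nat \<Rightarrow> (bool list \<times> bool) set \<Rightarrow> ennreal" where
  "conflict_cplx m g =
     (SUP \<mu> \<in> {\<mu>. \<forall>b. set_pmf (\<mu> b) \<subseteq> preimg g b}.
        INF t \<in> {t. computes m g t}. chi_val m \<mu> t)"

end

theory Submission
  imports Defs
begin

text \<open>Measure progress by the Bhattacharyya coefficient: for weights on the inputs, a leaf whose
  subcube has weights \<open>W\<^sub>0\<close>, \<open>W\<^sub>1\<close> on the two preimages contributes
  \<open>sqrt (W\<^sub>0 * W\<^sub>1)\<close>, which bounds the error made there. At a node with edge
  probabilities \<open>p\<^sub>0\<close>, \<open>p\<^sub>1\<close> the process conflicts with probability
  \<open>\<bar>p\<^sub>0 - p\<^sub>1\<bar>\<close>, while the coefficient is multiplied by at most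
  \<open>1 - (p\<^sub>0 - p\<^sub>1)\<^sup>2 / 2\<close>. By Cauchy-Schwarz over \<open>q\<close> levels, a tree of height
  \<open>q\<close> on which a conflict happens with probability at least \<open>1/2\<close> shrinks the coefficient by a
  factor \<open>1 - 1/(8 q)\<close>. If the conflict complexity is \<open>d\<close>, Markov's inequality provides
  such a tree with \<open>q = O(d)\<close> for every pair of conditional distributions, so \<open>O(q)\<close>
  consecutive phases, each with a tree adapted to the current subcube, leave a small error after
  \<open>O(d\<^sup>2)\<close> queries. The minimax principle turns this into a randomized algorithm.\<close>

section \<open>Tree height, truncation and the recursive leaf quantities\<close>

primrec height :: "dtree \<Rightarrow> nat" where
  "height (Leaf b) = 0"
| "height (Node j t0 t1) = Suc (max (height t0) (height t1))"

text \<open>The label at a cut is arbitrary: \<open>survival\<close>, \<open>affinity\<close> and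
  \<open>potential\<close> ignore labels, and \<open>relabel_leaves\<close> chooses the final
  ones.\<close>

primrec trunc_tree :: "dtree \<Rightarrow> nat \<Rightarrow> dtree" where
  "trunc_tree (Leaf b) q = Leaf b"
| "trunc_tree (Node j t0 t1) q =
     (case q of 0 \<Rightarrow> Leaf False | Suc q' \<Rightarrow> Node j (trunc_tree t0 q') (trunc_tree t1 q'))"

lemma num_queries_le_height: "num_queries t x \<le> height t"
  by (induction t) (auto simp: le_max_iff_disj)

lemma height_trunc_tree: "height (trunc_tree t q) \<le> q"
  by (induction t arbitrary: q) (auto split: nat.split)

lemma valid_trunc_tree: "valid_tree m t \<Longrightarrow> valid_tree m (trunc_tree t q)"
  by (induction t arbitrary: q) (auto split: nat.split)

text \<open>\<open>survival\<close> is the probability that the process reaches a leaf with its flag still set.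
  Replacing the minima by geometric means gives the normalised Bhattacharyya coefficient
  \<open>affinity\<close> of the two leaf distributions.\<close>

primrec survival :: "(bool \<Rightarrow> bool list pmf) \<Rightarrow> dtree \<Rightarrow> bool list set \<Rightarrow> real" where
  "survival \<mu> (Leaf b) S = 1"
| "survival \<mu> (Node j t0 t1) S =
     min (cprob (\<mu> False) j S) (cprob (\<mu> True) j S) * survival \<mu> t0 (S \<inter> {y. y ! j = False})
   + (1 - max (cprob (\<mu> False) j S) (cprob (\<mu> True) j S)) * survival \<mu> t1 (S \<inter> {y. y ! j = True})"

primrec affinity :: "(bool \<Rightarrow> bool list pmf) \<Rightarrow> dtree \<Rightarrow> bool list set \<Rightarrow> real" where
  "affinity \<mu> (Leaf b) S = 1"
| "affinity \<mu> (Node j t0 t1) S =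
     sqrt (cprob (\<mu> False) j S * cprob (\<mu> True) j S) * affinity \<mu> t0 (S \<inter> {y. y ! j = False})
   + sqrt ((1 - cprob (\<mu> False) j S) * (1 - cprob (\<mu> True) j S))
       * affinity \<mu> t1 (S \<inter> {y. y ! j = True})"

text \<open>The unnormalised Bhattacharyya coefficient. Since \<open>W\<close> is an arbitrary set
  function, one definition covers both probabilities and raw weights on the preimages.\<close>

primrec potential :: "(bool \<Rightarrow> bool list set \<Rightarrow> real) \<Rightarrow> dtree \<Rightarrow> bool list set \<Rightarrow> real" where
  "potential W (Leaf b) S = sqrt (W False S * W True S)"
| "potential W (Node j t0 t1) S =
     potential W t0 (S \<inter> {y. y ! j = False}) + potential W t1 (S \<inter> {y. y ! j = True})"

lemma cprob_nonneg: "0 \<le> cprob \<mu> j S"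
  by (simp add: cprob_def)

lemma cprob_le_1: "cprob \<mu> j S \<le> 1"
proof -
  have "measure_pmf.prob \<mu> (S \<inter> {y. y ! j = False}) \<le> measure_pmf.prob \<mu> S"
    by (rule measure_pmf.finite_measure_mono) auto
  then show ?thesis
    unfolding cprob_def by (intro divide_le_eq_1[THEN iffD2]) (auto simp: zero_less_measure_iff less_le)
qed

section \<open>Conflict probability against loss of affinity\<close>

text \<open>In the square of the left side, the cross term is regrouped as a product of
  \<open>sqrt (p * (1 - p))\<close> and \<open>sqrt (p' * (1 - p'))\<close>; the
  arithmetic-geometric mean inequality then leaves \<open>1 - (p - p')\<^sup>2\<close>, and
  \<open>1 - y \<le> (1 - y / 2)\<^sup>2\<close> finishes.\<close>

lemma bhattacharyya_le:
  fixes p p' :: real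
  assumes "0 \<le> p" "p \<le> 1" "0 \<le> p'" "p' \<le> 1"
  shows "sqrt (p * p') + sqrt ((1 - p) * (1 - p')) \<le> 1 - (p - p')\<^sup>2 / 2"
proof (rule power2_le_imp_le)
  have d: "(p - p')\<^sup>2 \<le> 1"
    using assms by (intro abs_square_le_1[THEN iffD2]) auto
  then show "0 \<le> 1 - (p - p')\<^sup>2 / 2" by simp
  have "sqrt (p * p') * sqrt ((1 - p) * (1 - p')) = sqrt (p * (1 - p)) * sqrt (p' * (1 - p'))"
    by (simp add: real_sqrt_mult)
  moreover have "2 * (sqrt (p * (1 - p)) * sqrt (p' * (1 - p'))) \<le> p * (1 - p) + p' * (1 - p')"
    using sum_squares_bound[of "sqrt (p * (1 - p))" "sqrt (p' * (1 - p'))"] assms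
    by (simp add: mult.assoc)
  ultimately have "(sqrt (p * p') + sqrt ((1 - p) * (1 - p')))\<^sup>2
      \<le> p * p' + (1 - p) * (1 - p') + (p * (1 - p) + p' * (1 - p'))"
    using assms by (simp add: power2_sum)
  also have "\<dots> = 1 - (p - p')\<^sup>2"
    by (simp add: power2_eq_square algebra_simps)
  also have "\<dots> \<le> (1 - (p - p')\<^sup>2 / 2)\<^sup>2"
    using zero_le_power2[of "(p - p')\<^sup>2 / 2"] power2_diff[of 1 "(p - p')\<^sup>2 / 2"] by simp
  finally show "(sqrt (p * p') + sqrt ((1 - p) * (1 - p')))\<^sup>2 \<le> (1 - (p - p')\<^sup>2 / 2)\<^sup>2" .
qed

lemma survival_bounds: "0 \<le> survival \<mu> t S" "survival \<mu> t S \<le> 1"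
proof (induction t arbitrary: S)
  case (Node j t0 t1)
  let ?p = "\<lambda>S. cprob (\<mu> False) j S" and ?p' = "\<lambda>S. cprob (\<mu> True) j S"
  have p: "0 \<le> min (?p S) (?p' S)" "0 \<le> 1 - max (?p S) (?p' S)" for S
    using cprob_nonneg cprob_le_1 by auto
  {
    case 1
    show ?case unfolding survival.simps using Node by (intro add_nonneg_nonneg mult_nonneg_nonneg p)
  next
    case 2
    have "survival \<mu> (Node j t0 t1) S \<le> min (?p S) (?p' S) * 1 + (1 - max (?p S) (?p' S)) * 1"
      unfolding survival.simps using Node by (intro add_mono mult_left_mono p)
    then show ?case by simp
  }
qed simp_all

lemma sqrt_mult_ge_min:
  fixes a b :: real
  assumes "0 \<le> a" "0 \<le> b"
  shows "min a b \<le> sqrt (a * b)"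
  by (rule real_le_rsqrt) (use assms in \<open>simp add: power2_eq_square min_def mult_left_mono mult_right_mono\<close>)

lemma affinity_le_1: "affinity \<mu> t S \<le> 1"
proof (induction t arbitrary: S)
  case (Node j t0 t1)
  let ?p = "cprob (\<mu> False) j S" and ?p' = "cprob (\<mu> True) j S"
  have p: "0 \<le> ?p" "?p \<le> 1" "0 \<le> ?p'" "?p' \<le> 1"
    using cprob_nonneg cprob_le_1 by auto
  have "affinity \<mu> (Node j t0 t1) S \<le> sqrt (?p * ?p') * 1 + sqrt ((1 - ?p) * (1 - ?p')) * 1"
    using p Node by (simp only: affinity.simps) (intro add_mono mult_left_mono; simp)
  also have "\<dots> \<le> 1" using bhattacharyya_le[OF p] zero_le_power2[of "?p - ?p'"] by linarith
  finally show ?case .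
qed simp

text \<open>Induction step of the Cauchy-Schwarz argument. Here \<open>u0\<close>, \<open>u1\<close>
  stand for the conflict probabilities in the two subtrees and \<open>h0\<close>, \<open>h1\<close>
  for their affinity deficits; one more level raises the constant from \<open>C\<close> to
  \<open>C + 2\<close>.\<close>

lemma survival_affinity_step:
  fixes p p' :: real
  assumes p: "0 \<le> p" "p \<le> 1" "0 \<le> p'" "p' \<le> 1" and C: "0 \<le> C"
    and h: "0 \<le> h0" "0 \<le> h1" and u0: "u0\<^sup>2 \<le> C * h0" and u1: "u1\<^sup>2 \<le> C * h1"
  shows "(\<bar>p - p'\<bar> + (min p p' * u0 + (1 - max p p') * u1))\<^sup>2
    \<le> (C + 2) * (1 - (sqrt (p * p') * (1 - h0) + sqrt ((1 - p) * (1 - p')) * (1 - h1)))"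
proof -
  define D where "D = \<bar>p - p'\<bar>"
  define m0 where "m0 = min p p'"
  define m1 where "m1 = 1 - max p p'"
  define a0 where "a0 = sqrt (p * p')"
  define a1 where "a1 = sqrt ((1 - p) * (1 - p'))"
  define V where "V = m0 * u0 + m1 * u1"
  define H where "H = a0 * h0 + a1 * h1"
  have m: "0 \<le> m0" "0 \<le> m1" "m0 + m1 \<le> 1" using p by (auto simp: m0_def m1_def)
  have am: "m0 \<le> a0" "m1 \<le> a1"
  proof -
    have "m1 = min (1 - p) (1 - p')" by (auto simp: m1_def)
    then show "m0 \<le> a0" "m1 \<le> a1"
      using sqrt_mult_ge_min[of p p'] sqrt_mult_ge_min[of "1 - p" "1 - p'"] p
      by (auto simp: m0_def a0_def a1_def)
  qed
  \<comment> \<open>Convexity of the square for weights of total mass at most 1, as an identity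
    whose last term is dropped.\<close>
  have "V\<^sup>2 = (m0 + m1) * (m0 * u0\<^sup>2 + m1 * u1\<^sup>2) - m0 * m1 * (u0 - u1)\<^sup>2"
    by (simp add: V_def power2_eq_square algebra_simps)
  also have "\<dots> \<le> (m0 + m1) * (m0 * u0\<^sup>2 + m1 * u1\<^sup>2)" using m by simp
  also have "\<dots> \<le> 1 * (m0 * u0\<^sup>2 + m1 * u1\<^sup>2)"
    using m by (intro mult_right_mono) auto
  also have "\<dots> \<le> a0 * (C * h0) + a1 * (C * h1)"
    using m am u0 u1 C h by (simp only: mult_1) (intro add_mono mult_mono; simp)
  also have "\<dots> = C * H" by (simp add: H_def algebra_simps)
  finally have V: "V\<^sup>2 \<le> C * H" .
  have H: "0 \<le> H" using m am h by (simp add: H_def)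
  \<comment> \<open>The mean inequality is balanced so that, together with \<open>D\<^sup>2\<close>
    and \<open>C * H\<close>, the right side adds up to exactly
    \<open>(C + 2) * (D\<^sup>2 / 2 + H)\<close>.\<close>
  have "2 * (D * V) \<le> C * D\<^sup>2 / 2 + 2 * H"
  proof (rule power2_le_imp_le)
    have "(2 * (D * V))\<^sup>2 = 4 * D\<^sup>2 * V\<^sup>2" by (simp add: power_mult_distrib)
    also have "\<dots> \<le> 4 * D\<^sup>2 * (C * H)" using V by (intro mult_left_mono) auto
    also have "\<dots> = (C * D\<^sup>2 / 2 + 2 * H)\<^sup>2 - (C * D\<^sup>2 / 2 - 2 * H)\<^sup>2"
      by (simp add: power2_eq_square algebra_simps)
    also have "\<dots> \<le> (C * D\<^sup>2 / 2 + 2 * H)\<^sup>2" by simp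
    finally show "(2 * (D * V))\<^sup>2 \<le> (C * D\<^sup>2 / 2 + 2 * H)\<^sup>2" .
    show "0 \<le> C * D\<^sup>2 / 2 + 2 * H" using C H by simp
  qed
  moreover have "(D + V)\<^sup>2 = D\<^sup>2 + 2 * (D * V) + V\<^sup>2"
    by (simp add: power2_sum)
  moreover have "(C + 2) * (D\<^sup>2 / 2 + H) = C * D\<^sup>2 / 2 + D\<^sup>2 + C * H + 2 * H"
    by (simp add: algebra_simps)
  ultimately have "(D + V)\<^sup>2 \<le> (C + 2) * (D\<^sup>2 / 2 + H)"
    using V by linarith
  \<comment> \<open>By \<open>bhattacharyya_le\<close>, \<open>D\<^sup>2 / 2\<close> is at most
    \<open>1 - (a0 + a1)\<close>, the deficit created at the node itself.\<close>
  also have "\<dots> \<le> (C + 2) * (1 - (a0 * (1 - h0) + a1 * (1 - h1)))"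
    using C bhattacharyya_le[OF p]
    by (intro mult_left_mono) (auto simp: H_def D_def a0_def a1_def algebra_simps)
  finally show ?thesis by (simp add: D_def V_def m0_def m1_def a0_def a1_def)
qed

text \<open>Each level adds 2 to the constant, and at a leaf the left side is 0. Only bounds in
  [0,1] on the edge probabilities enter, so the convention x/0 = 0 is harmless on null
  subcubes.\<close>

lemma survival_affinity:
  "height t \<le> q \<Longrightarrow> (1 - survival \<mu> t S)\<^sup>2 \<le> 2 * real q * (1 - affinity \<mu> t S)"
proof (induction t arbitrary: q S)
  case (Leaf b)
  then show ?case by simp
next
  case (Node j t0 t1)
  obtain q' where q: "q = Suc q'" "height t0 \<le> q'" "height t1 \<le> q'"
    using Node.prems by (cases q) auto
  let ?p = "cprob (\<mu> False) j S" and ?p' = "cprob (\<mu> True) j S"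
  define S0 where "S0 = S \<inter> {y. y ! j = False}"
  define S1 where "S1 = S \<inter> {y. y ! j = True}"
  have "(\<bar>?p - ?p'\<bar> + (min ?p ?p' * (1 - survival \<mu> t0 S0) + (1 - max ?p ?p') * (1 - survival \<mu> t1 S1)))\<^sup>2
    \<le> (2 * real q' + 2) * (1 - (sqrt (?p * ?p') * (1 - (1 - affinity \<mu> t0 S0))
        + sqrt ((1 - ?p) * (1 - ?p')) * (1 - (1 - affinity \<mu> t1 S1))))"
    by (rule survival_affinity_step)
      (simp_all add: Node.IH q cprob_nonneg cprob_le_1 affinity_le_1)
  also have "\<bar>?p - ?p'\<bar> + (min ?p ?p' * (1 - survival \<mu> t0 S0) + (1 - max ?p ?p') * (1 - survival \<mu> t1 S1))
     = 1 - survival \<mu> (Node j t0 t1) S"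
    by (auto simp: S0_def S1_def min_def max_def algebra_simps)
  finally show ?case by (simp add: S0_def S1_def q algebra_simps)
qed

section \<open>From normalised affinity to leaf weights\<close>

lemma prob_split_bit:
  "measure_pmf.prob p S = measure_pmf.prob p (S \<inter> {y. y ! j = False}) + measure_pmf.prob p (S \<inter> {y. y ! j = True})"
  by (subst measure_pmf.finite_measure_Union[symmetric]) (auto intro!: arg_cong2[where f = measure])

lemma potential_null:
  "measure_pmf.prob (\<mu> b) S = 0 \<Longrightarrow> potential (\<lambda>b. measure_pmf.prob (\<mu> b)) t S = 0"
proof (induction t arbitrary: S)
  case (Leaf c)
  then show ?case by (cases b) auto
next
  case (Node j t0 t1)
  then show ?case
    using prob_split_bit[of "\<mu> b" S j]
    by (simp add: add_nonneg_eq_0_iff)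
qed

text \<open>The edge probabilities multiply along each path, turning the measure of the starting set
  into that of the leaf.\<close>

lemma potential_eq_affinity:
  assumes "\<And>b. measure_pmf.prob (\<mu> b) S > 0"
  shows "potential (\<lambda>b. measure_pmf.prob (\<mu> b)) t S =
    sqrt (measure_pmf.prob (\<mu> False) S * measure_pmf.prob (\<mu> True) S) * affinity \<mu> t S"
  using assms
proof (induction t arbitrary: S)
  case (Leaf b)
  then show ?case by simp
next
  case (Node j t0 t1)
  define P where "P b = measure_pmf.prob (\<mu> b) S" for b
  define S0 where "S0 = S \<inter> {y. y ! j = False}"
  define S1 where "S1 = S \<inter> {y. y ! j = True}"
  have P: "P b > 0" for b using Node.prems by (simp add: P_def)
  have P0: "measure_pmf.prob (\<mu> b) S0 = P b * cprob (\<mu> b) j S" for b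
    using P[of b] by (simp add: P_def S0_def cprob_def)
  have P1: "measure_pmf.prob (\<mu> b) S1 = P b * (1 - cprob (\<mu> b) j S)" for b
    using prob_split_bit[of "\<mu> b" S j] P0[of b] by (simp add: S0_def S1_def P_def algebra_simps)
  have *: "potential (\<lambda>b. measure_pmf.prob (\<mu> b)) t' S' =
    sqrt (measure_pmf.prob (\<mu> False) S' * measure_pmf.prob (\<mu> True) S') * affinity \<mu> t' S'"
    if "\<And>S. (\<And>b. 0 < measure_pmf.prob (\<mu> b) S) \<Longrightarrow> potential (\<lambda>b. measure_pmf.prob (\<mu> b)) t' S =
      sqrt (measure_pmf.prob (\<mu> False) S * measure_pmf.prob (\<mu> True) S) * affinity \<mu> t' S" for t' S'
  proof (cases "\<forall>b. 0 < measure_pmf.prob (\<mu> b) S'")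
    case True
    then show ?thesis using that by blast
  next
    case False
    then obtain b where b: "measure_pmf.prob (\<mu> b) S' = 0"
      using measure_nonneg by (metis order.order_iff_strict)
    then show ?thesis using potential_null[of \<mu> b S' t'] by (cases b) auto
  qed
  show ?case
    unfolding potential.simps affinity.simps S0_def[symmetric] S1_def[symmetric] P_def[symmetric]
    using *[OF Node.IH(1), of S0] *[OF Node.IH(2), of S1]
    by (simp add: P0 P1 real_sqrt_mult distrib_left mult_ac)
qed

section \<open>Lower bound on the expected counter\<close>

lemma uniform_01_prob_algebra: "uniform_measure lborel {0..1::real} \<in> space (prob_algebra borel)"
  by (simp add: space_prob_algebra prob_space_uniform_measure)

lemma pmf_prob_algebra: "measure_pmf p \<in> space (prob_algebra (count_space UNIV))"
  by (simp add: space_prob_algebra measure_pmf.prob_space_axioms)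

lemma proc_prob_space:
  "proc \<mu> z t S nq n \<in> space (prob_algebra (count_space UNIV))"
proof (induction t arbitrary: S nq n)
  case (Leaf b)
  then show ?case by (simp add: space_prob_algebra prob_space_return)
next
  case (Node j t0 t1)
  have bind: "A \<bind> B \<in> space (prob_algebra N)"
    if "A \<in> space (prob_algebra M)" "B \<in> measurable M (prob_algebra N)"
    for A :: "'x measure" and B :: "'x \<Rightarrow> 'y measure" and M N
    using prob_space_bind'[OF that] sets_bind'[OF that] by (simp add: space_prob_algebra)
  show ?case
    by (cases nq; simp add: Let_def; (rule bind[OF uniform_01_prob_algebra] | rule bind[OF pmf_prob_algebra]))
      (auto intro!: measurable_If measurable_const Node.IH)
qed


lemma proc_nn_integral_bind_ge:
  assumes A: "A \<in> space (prob_algebra M)" and B: "B \<in> measurable M (prob_algebra (count_space UNIV))"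
    and f: "\<And>x. f x \<le> (\<integral>\<^sup>+ k. ennreal (real k) \<partial>B x)"
  shows "(\<integral>\<^sup>+ x. f x \<partial>A) \<le> (\<integral>\<^sup>+ k. ennreal (real k) \<partial>(A \<bind> B))"
proof -
  have "(\<integral>\<^sup>+ k. ennreal (real k) \<partial>(A \<bind> B)) = (\<integral>\<^sup>+ x. \<integral>\<^sup>+ k. ennreal (real k) \<partial>B x \<partial>A)"
    by (rule nn_integral_bind[where B = "count_space UNIV"])
      (use A measurable_prob_algebraD[OF B] in \<open>auto simp: space_prob_algebra cong: measurable_cong_sets\<close>)
  then show ?thesis using f by (simp add: nn_integral_mono)
qed

text \<open>The counter never decreases. This is all that is retained about runs after a
  conflict.\<close>

lemma proc_counter_ge: "ennreal (real n) \<le> (\<integral>\<^sup>+ k. ennreal (real k) \<partial>proc \<mu> z t S nq n)"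
proof (induction t arbitrary: S nq n)
  case (Leaf b)
  then show ?case by (simp add: nn_integral_return)
next
  case (Node j t0 t1)
  have const: "c \<le> (\<integral>\<^sup>+ k. ennreal (real k) \<partial>(A \<bind> B))"
    if "A \<in> space (prob_algebra M)" "B \<in> measurable M (prob_algebra (count_space UNIV))"
     "\<And>x. c \<le> (\<integral>\<^sup>+ k. ennreal (real k) \<partial>B x)"
    for A :: "'x measure" and B M and c :: ennreal
    using proc_nn_integral_bind_ge[OF that(1,2), of "\<lambda>_. c"] that(1,3)
    by (simp add: prob_space.emeasure_space_1 space_prob_algebra)
  have n: "ennreal (real n) \<le> ennreal (real (Suc n))"
    by (rule ennreal_leI) simp
  have IH: "ennreal (real n) \<le> (\<integral>\<^sup>+ k. ennreal (real k) \<partial>proc \<mu> z t0 S' nq' (Suc n))"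
    "ennreal (real n) \<le> (\<integral>\<^sup>+ k. ennreal (real k) \<partial>proc \<mu> z t1 S' nq' (Suc n))" for S' nq'
    using n Node.IH order_trans by blast+
  show ?case
    by (cases nq; simp add: Let_def; (rule const[OF uniform_01_prob_algebra] | rule const[OF pmf_prob_algebra]))
      (auto intro!: measurable_If measurable_const proc_prob_space IH Node.IH)
qed

text \<open>Integrates the step function that will bound the expected counter from below in terms of
  the threshold \<open>r\<close>. The intervals are half-open so that a point of the first forces
  \<open>lo > 0\<close> and a point of the second \<open>hi < 1\<close>: branches into null subcubes
  contribute nothing extra.\<close>

lemma nn_integral_uniform_two_steps:
  assumes "0 \<le> lo" "lo \<le> 1" "0 \<le> hi" "hi \<le> 1" "0 \<le> c" "0 \<le> u" "0 \<le> v"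
  shows "(\<integral>\<^sup>+ r. (ennreal c + ennreal u * indicator {0<..lo} r + ennreal v * indicator {hi<..1} r)
      \<partial>uniform_measure lborel {0..1::real}) = ennreal (c + u * lo + v * (1 - hi))"
proof -
  interpret prob_space "uniform_measure lborel {0..1::real}"
    by (simp add: prob_space_uniform_measure)
  have "{0..1} \<inter> {0<..lo} = {0<..lo}" "{0..1} \<inter> {hi<..1} = {hi<..1}"
    using assms by auto
  then have "emeasure (uniform_measure lborel {0..1::real}) {0<..lo} = ennreal lo"
    "emeasure (uniform_measure lborel {0..1::real}) {hi<..1} = ennreal (1 - hi)"
    using assms by (simp_all add: emeasure_uniform_measure divide_ennreal flip: ennreal_1)
  then show ?thesis
    using assms emeasure_space_1
    by (simp add: nn_integral_add nn_integral_cmult_indicator ennreal_mult ennreal_plus del: emeasure_uniform_measure)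
qed

text \<open>The counter reaches \<open>q + 1\<close> unless a conflict occurs earlier, because a leaf of a tree that
  separates the two supports is never reached without a conflict.\<close>

lemma proc_expectation_ge:
  assumes "\<And>b x. x \<in> S \<Longrightarrow> x \<in> set_pmf (\<mu> b) \<Longrightarrow> eval_tree t x = b"
    and "\<And>b. measure_pmf.prob (\<mu> b) S > 0"
  shows "ennreal (real n + 1 + real q * survival \<mu> (trunc_tree t (Suc q)) S)
    \<le> (\<integral>\<^sup>+ k. ennreal (real k) \<partial>proc \<mu> z t S True n)"
  using assms
proof (induction t arbitrary: S n q)
  case (Leaf b)
  \<comment> \<open>Vacuous case: a point of the support with the opposite label would reach this
    leaf.\<close>
  have "S \<inter> set_pmf (\<mu> (\<not> b)) \<noteq> {}"
    using Leaf.prems(2)[of "\<not> b"] by (metis Int_commute measure_Int_set_pmf measure_empty less_irrefl)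
  then show ?case using Leaf.prems(1)[of _ "\<not> b"] by auto
next
  case (Node j t0 t1)
  define S0 where "S0 = S \<inter> {y. y ! j = False}"
  define S1 where "S1 = S \<inter> {y. y ! j = True}"
  define lo where "lo = min (cprob (\<mu> False) j S) (cprob (\<mu> True) j S)"
  define hi where "hi = max (cprob (\<mu> False) j S) (cprob (\<mu> True) j S)"
  define u where "u = survival \<mu> (trunc_tree t0 q) S0"
  define v where "v = survival \<mu> (trunc_tree t1 q) S1"
  define B where "B = (\<lambda>r. if r \<le> lo then proc \<mu> z t0 S0 True (Suc n)
          else if r \<ge> hi then proc \<mu> z t1 S1 True (Suc n)
          else if r \<le> cprob (\<mu> z) j S then proc \<mu> z t0 S0 False (Suc n)
          else proc \<mu> z t1 S1 False (Suc n))"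
  have lohi: "0 \<le> lo" "lo \<le> 1" "0 \<le> hi" "hi \<le> 1" "lo \<le> hi"
    using cprob_nonneg cprob_le_1 by (auto simp: lo_def hi_def le_max_iff_disj min_le_iff_disj)
  have uv: "0 \<le> u" "0 \<le> v" by (simp_all add: u_def v_def survival_bounds)
  have pos0: "measure_pmf.prob (\<mu> b) S0 > 0" if "lo > 0" for b
  proof -
    have "cprob (\<mu> b) j S > 0" using that by (cases b) (auto simp: lo_def)
    then show ?thesis
      using measure_nonneg by (auto simp: cprob_def S0_def less_le)
  qed
  have pos1: "measure_pmf.prob (\<mu> b) S1 > 0" if "hi < 1" for b
  proof (rule ccontr)
    assume "\<not> ?thesis"
    then have "measure_pmf.prob (\<mu> b) S1 = 0" using measure_nonneg by (metis less_le)
    then have "cprob (\<mu> b) j S = 1"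
      using prob_split_bit[of "\<mu> b" S j] Node.prems(2)[of b] by (simp add: cprob_def S1_def)
    then show False using that by (cases b) (auto simp: hi_def)
  qed
  \<comment> \<open>One level down, \<open>q * s\<close> is at most \<open>1 + (q - 1) * s\<close>
    because the survival probability \<open>s\<close> is at most 1; the lost unit is paid by the
    step from \<open>n\<close> to \<open>Suc n\<close>. For \<open>q = 0\<close> monotonicity of the
    counter suffices.\<close>
  have sub: "ennreal (real n + 1 + real q * survival \<mu> (trunc_tree t' q) S')
      \<le> (\<integral>\<^sup>+ k. ennreal (real k) \<partial>proc \<mu> z t' S' True (Suc n))"
    if "\<And>q. ennreal (real (Suc n) + 1 + real q * survival \<mu> (trunc_tree t' (Suc q)) S')
      \<le> (\<integral>\<^sup>+ k. ennreal (real k) \<partial>proc \<mu> z t' S' True (Suc n))" for t' S'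
  proof (cases q)
    case 0
    then show ?thesis using proc_counter_ge[of "Suc n" \<mu> z t' S' True] by (simp add: add.commute)
  next
    case (Suc q')
    have "real n + 1 + real q * survival \<mu> (trunc_tree t' q) S'
        \<le> real (Suc n) + 1 + real q' * survival \<mu> (trunc_tree t' (Suc q')) S'"
      using survival_bounds(2)[of \<mu> "trunc_tree t' q" S'] Suc by (simp add: algebra_simps)
    then show ?thesis using that[of q'] ennreal_leI order_trans by blast
  qed
  have ev0: "eval_tree t0 x = b" if "x \<in> S0" "x \<in> set_pmf (\<mu> b)" for b x
    using Node.prems(1)[of x b] that by (simp add: S0_def)
  have ev1: "eval_tree t1 x = b" if "x \<in> S1" "x \<in> set_pmf (\<mu> b)" for b x
    using Node.prems(1)[of x b] that by (simp add: S1_def)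
  have sub0: "ennreal (real n + 1 + real q * u)
      \<le> (\<integral>\<^sup>+ k. ennreal (real k) \<partial>proc \<mu> z t0 S0 True (Suc n))" if "lo > 0"
    unfolding u_def by (rule sub, rule Node.IH(1)) (use ev0 pos0 that in blast)+
  have sub1: "ennreal (real n + 1 + real q * v)
      \<le> (\<integral>\<^sup>+ k. ennreal (real k) \<partial>proc \<mu> z t1 S1 True (Suc n))" if "hi < 1"
    unfolding v_def by (rule sub, rule Node.IH(2)) (use ev1 pos1 that in blast)+
  have "ennreal (real n + 1 + real q * survival \<mu> (trunc_tree (Node j t0 t1) (Suc q)) S)
    = ennreal ((real n + 1) + (real q * u) * lo + (real q * v) * (1 - hi))"
    by (simp add: u_def v_def S0_def S1_def lo_def hi_def algebra_simps)
  also have "\<dots> = (\<integral>\<^sup>+ r. (ennreal (real n + 1) + ennreal (real q * u) * indicator {0<..lo} r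
      + ennreal (real q * v) * indicator {hi<..1} r) \<partial>uniform_measure lborel {0..1::real})"
    by (rule nn_integral_uniform_two_steps[symmetric]) (use lohi uv in auto)
  also have "\<dots> \<le> (\<integral>\<^sup>+ k. ennreal (real k) \<partial>(uniform_measure lborel {0..1::real} \<bind> B))"
  proof (rule proc_nn_integral_bind_ge[OF uniform_01_prob_algebra])
    show "B \<in> borel \<rightarrow>\<^sub>M prob_algebra (count_space UNIV)"
      unfolding B_def by (auto intro!: measurable_If measurable_const proc_prob_space)
    fix r :: real
    have "ennreal (real n + 1) \<le> (\<integral>\<^sup>+ k. ennreal (real k) \<partial>B r)"
      using proc_counter_ge[of "Suc n"] by (simp add: B_def add.commute)
    moreover have "ennreal (real n + 1 + real q * u) \<le> (\<integral>\<^sup>+ k. ennreal (real k) \<partial>B r)" if "0 < r" "r \<le> lo"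
      using sub0 that by (simp add: B_def)
    moreover have "ennreal (real n + 1 + real q * v) \<le> (\<integral>\<^sup>+ k. ennreal (real k) \<partial>B r)" if "hi < r" "r \<le> 1"
      using sub1 that lohi by (simp add: B_def)
    ultimately show "ennreal (real n + 1) + ennreal (real q * u) * indicator {0<..lo} r
      + ennreal (real q * v) * indicator {hi<..1} r \<le> (\<integral>\<^sup>+ k. ennreal (real k) \<partial>B r)"
      using lohi uv by (auto simp: indicator_def simp flip: ennreal_plus)
  qed
  also have "uniform_measure lborel {0..1::real} \<bind> B = proc \<mu> z (Node j t0 t1) S True n"
    unfolding B_def S0_def S1_def lo_def hi_def by (simp only: proc.simps Let_def if_True)
  finally show ?case .
qed

lemma chi_val_ge:
  assumes "computes m g t" "\<And>b. set_pmf (\<mu> b) \<subseteq> preimg g b" "\<And>b. preimg g b \<subseteq> cube m"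
  shows "ennreal (1 + real q * survival \<mu> (trunc_tree t (Suc q)) (cube m)) \<le> chi_val m \<mu> t"
proof -
  have "measure_pmf.prob (\<mu> b) (cube m) = 1" for b
    using assms(2,3) by (auto simp: measure_pmf.prob_eq_1 AE_measure_pmf_iff)
  then show ?thesis
    using proc_expectation_ge[of "cube m" \<mu> t 0 q False] assms
    by (auto simp: chi_val_def computes_def subset_iff)
qed

text \<open>Markov's inequality: as \<open>q\<close> is at least \<open>4 * d\<close>, survival of
  the first \<open>q\<close> queries with probability above 1/2 would push the expected counter
  beyond \<open>2 * d\<close>. A conflict thus has probability at least 1/2, and
  \<open>(1 / 2)\<^sup>2 / (2 * q)\<close> is the claimed deficit.\<close>

lemma affinity_trunc_le:
  assumes t: "computes m g t" and \<mu>: "\<And>b. set_pmf (\<mu> b) \<subseteq> preimg g b" and g: "\<And>b. preimg g b \<subseteq> cube m"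
    and d: "1 \<le> d" and chi: "chi_val m \<mu> t \<le> ennreal (2 * d)" and q: "4 * d \<le> real q"
  shows "affinity \<mu> (trunc_tree t q) (cube m) \<le> 1 - 1 / (8 * real q)"
proof -
  let ?s = "survival \<mu> (trunc_tree t q) (cube m)"
  obtain q' where q': "q = Suc q'" using d q by (cases q) auto
  have "ennreal (1 + real q' * ?s) \<le> ennreal (2 * d)"
    using chi_val_ge[OF t \<mu> g, of q'] chi order_trans by (auto simp: q')
  then have *: "1 + real q' * ?s \<le> 2 * d" using d by (simp add: ennreal_le_iff)
  have "?s \<le> 1 / 2"
  proof (rule ccontr)
    assume "\<not> ?thesis"
    then have "real q' * (1 / 2) \<le> real q' * ?s" by (intro mult_left_mono) auto
    then show False using * q q' by simp
  qed
  then have "(1 / 2)\<^sup>2 \<le> (1 - ?s)\<^sup>2" by (intro power_mono) auto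
  also have "\<dots> \<le> 2 * real q * (1 - affinity \<mu> (trunc_tree t q) (cube m))"
    by (rule survival_affinity[OF height_trunc_tree])
  finally show ?thesis using q' by (simp add: field_simps power2_eq_square)
qed

section \<open>Phases and the distributional algorithm\<close>

lemma exists_pmf_proportional:
  fixes w :: "'a \<Rightarrow> real"
  assumes A: "finite A" and w: "\<And>x. 0 \<le> w x" and pos: "0 < sum w A"
  shows "\<exists>p. set_pmf p \<subseteq> A \<and> (\<forall>X. measure_pmf.prob p X = sum w (A \<inter> X) / sum w A)"
proof -
  define f where "f x = (if x \<in> A then w x / sum w A else 0)" for x
  have f: "0 \<le> f x" for x using w pos by (simp add: f_def)
  have "(\<integral>\<^sup>+ x. ennreal (f x) \<partial>count_space UNIV) = (\<Sum>x\<in>A. ennreal (f x))"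
    by (rule nn_integral_count_space'[OF A]) (auto simp: f_def)
  also have "\<dots> = ennreal (\<Sum>x\<in>A. f x)" using f by (simp add: sum_ennreal)
  also have "(\<Sum>x\<in>A. f x) = 1" using pos by (simp add: f_def flip: sum_divide_distrib)
  finally have one: "(\<integral>\<^sup>+ x. ennreal (f x) \<partial>count_space UNIV) = 1" by simp
  have pmf: "pmf (embed_pmf f) x = f x" for x by (rule pmf_embed_pmf[OF f one])
  have sub: "set_pmf (embed_pmf f) \<subseteq> A" by (auto simp: set_pmf_iff pmf f_def split: if_splits)
  have "measure_pmf.prob (embed_pmf f) X = sum w (A \<inter> X) / sum w A" for X
  proof -
    have "measure_pmf.prob (embed_pmf f) X = measure_pmf.prob (embed_pmf f) (A \<inter> X)"
      by (rule measure_prob_cong_0) (use sub in \<open>auto simp: set_pmf_iff\<close>)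
    also have "\<dots> = (\<Sum>x\<in>A \<inter> X. f x)" using A by (simp add: measure_measure_pmf_finite pmf)
    also have "\<dots> = sum w (A \<inter> X) / sum w A" by (simp add: f_def flip: sum_divide_distrib)
    finally show ?thesis .
  qed
  then show ?thesis using sub by blast
qed

text \<open>Transfers the bound from normalised conditional distributions on the cube to raw weights
  on a subcube.\<close>

lemma potential_scale:
  assumes "\<And>b X. W' b (S \<inter> X) = c b * W b X"
  shows "potential W' t (S \<inter> X) = sqrt (c False * c True) * potential W t X"
  by (induction t arbitrary: X) (simp_all add: assms Int_assoc real_sqrt_mult algebra_simps)

text \<open>Every leaf is replaced by a tree chosen for its own subcube; the potential is a sum over
  leaves, so the factor carries over.\<close>

lemma potential_graft:
  assumes "\<And>S. \<exists>t. valid_tree m t \<and> height t \<le> k \<and> potential W t S \<le> \<rho> * sqrt (W False S * W True S)"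
    and "valid_tree m t"
  shows "\<exists>t'. valid_tree m t' \<and> height t' \<le> height t + k \<and> potential W t' S \<le> \<rho> * potential W t S"
  using assms(2)
proof (induction t arbitrary: S)
  case (Leaf b)
  then show ?case using assms(1)[of S] by simp
next
  case (Node j t0 t1)
  obtain t0' where t0': "valid_tree m t0'" "height t0' \<le> height t0 + k"
    "potential W t0' (S \<inter> {y. y ! j = False}) \<le> \<rho> * potential W t0 (S \<inter> {y. y ! j = False})"
    using Node by auto
  obtain t1' where t1': "valid_tree m t1'" "height t1' \<le> height t1 + k"
    "potential W t1' (S \<inter> {y. y ! j = True}) \<le> \<rho> * potential W t1 (S \<inter> {y. y ! j = True})"
    using Node by auto
  show ?case
    by (rule exI[of _ "Node j t0' t1'"]) (use Node.prems t0' t1' in \<open>auto simp: algebra_simps\<close>)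
qed

lemma potential_iterate:
  assumes step: "\<And>S. \<exists>t. valid_tree m t \<and> height t \<le> q \<and> potential W t S \<le> \<rho> * sqrt (W False S * W True S)"
    and \<rho>: "0 \<le> \<rho>"
  shows "\<exists>t. valid_tree m t \<and> height t \<le> K * q \<and> potential W t S \<le> \<rho> ^ K * sqrt (W False S * W True S)"
proof (induction K arbitrary: S)
  case 0
  then show ?case by (intro exI[of _ "Leaf False"]) auto
next
  case (Suc K)
  obtain t where t: "valid_tree m t" "height t \<le> q" "potential W t S \<le> \<rho> * sqrt (W False S * W True S)"
    using step by blast
  obtain t' where t': "valid_tree m t'" "height t' \<le> height t + K * q" "potential W t' S \<le> \<rho> ^ K * potential W t S"
    using potential_graft[OF Suc.IH t(1), of S] by blast
  have "potential W t' S \<le> \<rho> ^ K * (\<rho> * sqrt (W False S * W True S))"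
    using t'(3) mult_left_mono[OF t(3), of "\<rho> ^ K"] \<rho> by simp
  then show ?case using t t' by (intro exI[of _ t']) (simp add: algebra_simps)
qed

text \<open>Every string is related to some bit, so errors occur only on valid inputs of the
  opposite value.\<close>

lemma partial_fn_not_in:
  assumes "partial_fn m g"
  shows "{x \<in> cube m. (x, b) \<notin> g} = preimg g (\<not> b)"
  using assms by (cases b) (auto simp: partial_fn_def preimg_def ex_bool_eq)

lemma finite_cube: "finite (cube m)"
  using finite_lists_length_eq[of "UNIV :: bool set" m] by (simp add: cube_def)

text \<open>Each leaf takes the label of the heavier preimage; its error is the smaller weight, at
  most the geometric mean of the two.\<close>

lemma relabel_leaves:
  fixes w :: "bool list \<Rightarrow> real"
  assumes g: "partial_fn m g" and w: "\<And>x. 0 \<le> w x" and t: "valid_tree m t"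
  shows "\<exists>t'. valid_tree m t' \<and> height t' = height t \<and>
    sum w {x \<in> cube m. x \<in> S \<and> (x, eval_tree t' x) \<notin> g} \<le> potential (\<lambda>b S. sum w (preimg g b \<inter> S)) t S"
  using t
proof (induction t arbitrary: S)
  case (Leaf c)
  define W where "W b = sum w (preimg g b \<inter> S)" for b
  have W: "0 \<le> W b" for b using w by (simp add: W_def sum_nonneg)
  define b where "b = (W False \<le> W True)"
  have "{x \<in> cube m. x \<in> S \<and> (x, b) \<notin> g} = preimg g (\<not> b) \<inter> S"
    using partial_fn_not_in[OF g, of b] by blast
  moreover have "W (\<not> b) \<le> min (W False) (W True)" by (cases "W False \<le> W True") (simp_all add: b_def)
  ultimately show ?case
    using sqrt_mult_ge_min[OF W W, of False True]
    by (intro exI[of _ "Leaf b"]) (auto simp: W_def)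
next
  case (Node j t0 t1)
  define S0 where "S0 = S \<inter> {y. y ! j = False}"
  define S1 where "S1 = S \<inter> {y. y ! j = True}"
  obtain t0' where t0': "valid_tree m t0'" "height t0' = height t0"
    "sum w {x \<in> cube m. x \<in> S0 \<and> (x, eval_tree t0' x) \<notin> g} \<le> potential (\<lambda>b S. sum w (preimg g b \<inter> S)) t0 S0"
    using Node by auto
  obtain t1' where t1': "valid_tree m t1'" "height t1' = height t1"
    "sum w {x \<in> cube m. x \<in> S1 \<and> (x, eval_tree t1' x) \<notin> g} \<le> potential (\<lambda>b S. sum w (preimg g b \<inter> S)) t1 S1"
    using Node by auto
  have "{x \<in> cube m. x \<in> S \<and> (x, eval_tree (Node j t0' t1') x) \<notin> g}
    = {x \<in> cube m. x \<in> S0 \<and> (x, eval_tree t0' x) \<notin> g} \<union> {x \<in> cube m. x \<in> S1 \<and> (x, eval_tree t1' x) \<notin> g}"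
    by (auto simp: S0_def S1_def)
  moreover have "sum w \<dots> = sum w {x \<in> cube m. x \<in> S0 \<and> (x, eval_tree t0' x) \<notin> g}
      + sum w {x \<in> cube m. x \<in> S1 \<and> (x, eval_tree t1' x) \<notin> g}"
    by (rule sum.union_disjoint) (auto simp: S0_def S1_def finite_cube)
  ultimately show ?case using t0' t1' Node.prems
    by (intro exI[of _ "Node j t0' t1'"]) (auto simp: S0_def S1_def)
qed

text \<open>Conditioning the weights on a subcube again gives distributions supported on the
  preimages, so \<open>trees\<close> applies anew in every phase.\<close>

lemma distributional_tree:
  fixes w :: "bool list \<Rightarrow> real"
  assumes g: "partial_fn m g" and d: "1 \<le> d" and q: "4 * d \<le> real q"
    and trees: "\<And>\<mu>. (\<And>b. set_pmf (\<mu> b) \<subseteq> preimg g b) \<Longrightarrow> \<exists>t. computes m g t \<and> chi_val m \<mu> t \<le> ennreal (2 * d)"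
    and w: "\<And>x. 0 \<le> w x"
  shows "\<exists>t. valid_tree m t \<and> height t \<le> 16 * q * q \<and>
    sum w {x \<in> cube m. (x, eval_tree t x) \<notin> g} \<le> 1 / 5 * sum w (cube m)"
proof -
  define W where "W = (\<lambda>b S. sum w (preimg g b \<inter> S))"
  define \<rho> where "\<rho> = 1 - 1 / (8 * real q)"
  have q0: "1 \<le> real q" using d q by simp
  have \<rho>: "0 \<le> \<rho>" using q0 by (simp add: \<rho>_def)
  have pc: "preimg g b \<subseteq> cube m" for b using g by (auto simp: partial_fn_def preimg_def)
  have fin: "finite (preimg g b)" for b using pc finite_cube finite_subset by blast
  have W0: "0 \<le> W b S" for b S using w by (simp add: W_def sum_nonneg)
  have step: "\<exists>t. valid_tree m t \<and> height t \<le> q \<and> potential W t S \<le> \<rho> * sqrt (W False S * W True S)" for S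
  proof (cases "\<forall>b. 0 < W b S")
    \<comment> \<open>With one weight zero there is no potential left to reduce, and a leaf will
      do.\<close>
    case False
    then have "\<exists>b. W b S = 0" using W0 by (metis less_le)
    then have "sqrt (W False S * W True S) = 0" by (metis (full_types) mult_eq_0_iff real_sqrt_zero)
    then show ?thesis by (intro exI[of _ "Leaf False"]) (simp only: height.simps potential.simps valid_tree.simps; simp)
  next
    case True
    have "\<forall>b. \<exists>p. set_pmf p \<subseteq> preimg g b \<inter> S \<and>
        (\<forall>X. measure_pmf.prob p X = sum w (preimg g b \<inter> S \<inter> X) / W b S)"
      using True exists_pmf_proportional[of "preimg g _ \<inter> S" w] fin w unfolding W_def by blast
    then obtain \<mu> where \<mu>: "\<And>b. set_pmf (\<mu> b) \<subseteq> preimg g b \<inter> S"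
      "\<And>b X. measure_pmf.prob (\<mu> b) X = sum w (preimg g b \<inter> S \<inter> X) / W b S" by metis
    have \<mu>g: "set_pmf (\<mu> b) \<subseteq> preimg g b" for b using \<mu>(1) by blast
    obtain t where t: "computes m g t" "chi_val m \<mu> t \<le> ennreal (2 * d)" using trees \<mu>g by blast
    let ?t = "trunc_tree t q"
    have one: "measure_pmf.prob (\<mu> b) (cube m) = 1" for b
      using \<mu>g pc by (auto simp: measure_pmf.prob_eq_1 AE_measure_pmf_iff)
    have "potential W ?t S = potential W ?t (S \<inter> UNIV)" by simp
    also have "\<dots> = sqrt (W False S * W True S) * potential (\<lambda>b. measure_pmf.prob (\<mu> b)) ?t UNIV"
      by (rule potential_scale) (use True in \<open>simp add: \<mu>(2) less_imp_neq[symmetric]; simp add: W_def Int_assoc\<close>)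
    also have "potential (\<lambda>b. measure_pmf.prob (\<mu> b)) ?t UNIV = potential (\<lambda>b. measure_pmf.prob (\<mu> b)) ?t (cube m \<inter> UNIV)"
    proof -
      have "measure_pmf.prob (\<mu> b) (cube m \<inter> X) = 1 * measure_pmf.prob (\<mu> b) X" for b X
      proof -
        have "preimg g b \<inter> S \<inter> (cube m \<inter> X) = preimg g b \<inter> S \<inter> X" using pc[of b] by blast
        then show ?thesis by (simp add: \<mu>(2))
      qed
      from potential_scale[where W' = "\<lambda>b. measure_pmf.prob (\<mu> b)" and c = "\<lambda>_. 1", OF this, of ?t UNIV]
      show ?thesis by simp
    qed
    also have "\<dots> = affinity \<mu> ?t (cube m)"
      using potential_eq_affinity[of \<mu> "cube m" ?t] by (simp add: one)
    also have "sqrt (W False S * W True S) * \<dots> \<le> sqrt (W False S * W True S) * \<rho>"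
      unfolding \<rho>_def using affinity_trunc_le[OF t(1) \<mu>g pc d t(2) q] W0
      by (intro mult_left_mono) auto
    finally show ?thesis
      using t(1) by (intro exI[of _ ?t]) (auto simp: computes_def valid_trunc_tree height_trunc_tree mult.commute)
  qed
  obtain t where t: "valid_tree m t" "height t \<le> 16 * q * q"
    "potential W t UNIV \<le> \<rho> ^ (16 * q) * sqrt (W False UNIV * W True UNIV)"
    using potential_iterate[OF step \<rho>, of "16 * q" UNIV] by blast
  obtain t' where t': "valid_tree m t'" "height t' = height t"
    "sum w {x \<in> cube m. (x, eval_tree t' x) \<notin> g} \<le> potential W t UNIV"
    using relabel_leaves[OF g _ t(1), where S = UNIV and w = w] w by (auto simp: W_def)
  \<comment> \<open>The \<open>16 * q\<close> phases are chosen to give the factor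
    \<open>exp (- 2)\<close>, at most 2/5. The initial potential is at most half the total weight,
    which yields the error 1/5.\<close>
  have "\<rho> \<le> exp (- 1 / (8 * real q))" using exp_ge_add_one_self[of "- 1 / (8 * real q)"] by (simp add: \<rho>_def)
  then have "\<rho> ^ (16 * q) \<le> exp (- 1 / (8 * real q)) ^ (16 * q)" using \<rho> by (rule power_mono)
  also have "\<dots> = exp (real (16 * q) * (- 1 / (8 * real q)))" by (rule exp_of_nat_mult[symmetric])
  also have "\<dots> = exp (- 2)" using q0 by simp
  also have "\<dots> \<le> 2 / 5"
  proof -
    have "5 / 2 \<le> exp (2::real)" using exp_ge_add_one_self[of 2] by simp
    then show ?thesis by (simp add: exp_minus field_simps)
  qed
  finally have "\<rho> ^ (16 * q) \<le> 2 / 5" .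
  then have "\<rho> ^ (16 * q) * sqrt (W False UNIV * W True UNIV) \<le> 2 / 5 * ((W False UNIV + W True UNIV) / 2)"
    using W0 arith_geo_mean_sqrt[of "W False UNIV" "W True UNIV"] \<rho> by (intro mult_mono) auto
  also have "W False UNIV + W True UNIV = sum w (preimg g False \<union> preimg g True)"
    unfolding W_def by (subst sum.union_disjoint) (simp_all add: fin, auto simp: preimg_def)
  also have "\<dots> \<le> sum w (cube m)"
    by (rule sum_mono2) (use pc w finite_cube in auto)
  finally show ?thesis using t t' by (intro exI[of _ t']) auto
qed

section \<open>Minimax by multiplicative weights, and the final bound\<close>

text \<open>The strategies are found one after another, each against the distribution that doubles the
  weight of a point for every earlier strategy erring on it.\<close>

lemma multiplicative_weights:
  assumes X: "finite X"
    and strategy: "\<And>w :: 'x \<Rightarrow> real. (\<And>x. 0 \<le> w x) \<Longrightarrow> \<exists>t\<in>A. sum w {x \<in> X. bad t x} \<le> 1 / 5 * sum w X"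
  shows "\<exists>P. set_pmf P \<subseteq> A \<and> (\<forall>x\<in>X. measure_pmf.prob P {t. bad t x} \<le> 1 / 3)"
proof -
  define N where "N = real (card X)"
  \<comment> \<open>Doubling points that carry at most a fifth of the weight multiplies the total by
    at most 6/5.\<close>
  have rounds: "\<exists>ts. length ts = T \<and> set ts \<subseteq> A \<and>
      (\<Sum>x\<in>X. 2 ^ length (filter (\<lambda>t. bad t x) ts)) \<le> (6 / 5) ^ T * N" for T
  proof (induction T)
    case 0
    then show ?case by (simp add: N_def)
  next
    case (Suc T)
    then obtain ts where ts: "length ts = T" "set ts \<subseteq> A"
      "(\<Sum>x\<in>X. 2 ^ length (filter (\<lambda>t. bad t x) ts)) \<le> (6 / 5) ^ T * N" by blast
    define w :: "'x \<Rightarrow> real" where "w x = 2 ^ length (filter (\<lambda>t. bad t x) ts)" for x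
    obtain t where t: "t \<in> A" "sum w {x \<in> X. bad t x} \<le> 1 / 5 * sum w X"
      using strategy[of w] by (auto simp: w_def)
    have "(\<Sum>x\<in>X. 2 ^ length (filter (\<lambda>t. bad t x) (t # ts))) = (\<Sum>x\<in>X. w x + (if bad t x then w x else 0))"
      by (intro sum.cong) (auto simp: w_def)
    also have "\<dots> = sum w X + sum w {x \<in> X. bad t x}"
      using X by (simp add: sum.distrib sum.inter_filter)
    also have "\<dots> \<le> 6 / 5 * ((6 / 5) ^ T * N)" using t ts(3) by (simp add: w_def)
    finally show ?case using t ts by (intro exI[of _ "t # ts"]) simp
  qed
  \<comment> \<open>125/108 is \<open>2 / (6 / 5) ^ 3\<close>. With this \<open>T\<close>, a point
    on which \<open>k\<close> strategies err satisfies \<open>2 ^ (3 * k) < 2 ^ T\<close>, that is,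
    fewer than a third err. The summand 1 forces \<open>T > 0\<close>.\<close>
  obtain T where T: "N ^ 3 + 1 < (125 / 108) ^ T" using real_arch_pow[of "125 / 108"] by auto
  have T0: "0 < T" using T by (cases T) (auto simp: N_def)
  obtain ts where ts: "length ts = T" "set ts \<subseteq> A"
    "(\<Sum>x\<in>X. 2 ^ length (filter (\<lambda>t. bad t x) ts)) \<le> (6 / 5) ^ T * N" using rounds by blast
  \<comment> \<open>Sampling positions of the list keeps the multiplicity of repeated
    strategies.\<close>
  define P where "P = map_pmf ((!) ts) (pmf_of_set {..<T})"
  have ne: "{..<T} \<noteq> {}" using T0 by auto
  have "set_pmf P = (!) ts ` {..<T}" using ne by (simp add: P_def)
  then have "set_pmf P \<subseteq> A" using ts(1) by (auto intro!: subsetD[OF ts(2)])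
  moreover have "measure_pmf.prob P {t. bad t x} \<le> 1 / 3" if x: "x \<in> X" for x
  proof -
    define k where "k = length (filter (\<lambda>t. bad t x) ts)"
    have "(2::real) ^ k \<le> (\<Sum>x\<in>X. 2 ^ length (filter (\<lambda>t. bad t x) ts))"
      unfolding k_def using X x by (intro member_le_sum) auto
    then have "(2::real) ^ k \<le> (6 / 5) ^ T * N" using ts(3) by linarith
    then have "((2::real) ^ k) ^ 3 \<le> ((6 / 5) ^ T * N) ^ 3" by (rule power_mono) simp
    also have "\<dots> = (216 / 125) ^ T * N ^ 3"
    proof -
      have "((6 / 5 :: real) ^ T) ^ 3 = ((6 / 5) ^ 3) ^ T"
        by (simp only: power_mult[symmetric] mult.commute)
      also have "(6 / 5 :: real) ^ 3 = 216 / 125" by (simp add: power_divide)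
      finally show ?thesis by (simp only: power_mult_distrib)
    qed
    also have "\<dots> < (216 / 125) ^ T * (125 / 108) ^ T"
      using T by (intro mult_strict_left_mono) auto
    also have "\<dots> = 2 ^ T" by (simp flip: power_mult_distrib)
    finally have "(2::real) ^ (k * 3) < 2 ^ T" by (simp add: power_mult)
    then have "k * 3 < T" by simp
    have "{i. i < T \<and> bad (ts ! i) x} = {..<T} \<inter> {i. bad (ts ! i) x}" by auto
    then have "measure_pmf.prob P {t. bad t x} = real k / real T"
      using ne ts(1) by (simp add: P_def measure_pmf_of_set k_def length_filter_conv_card)
    moreover have "real k * 3 < real T" using \<open>k * 3 < T\<close> by linarith
    ultimately show ?thesis using T0 by (simp add: pos_divide_le_eq)
  qed
  ultimately show ?thesis by blast
qed

lemma rand_query_cplx_le: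
  assumes "partial_fn m g" "1 \<le> d" "4 * d \<le> real q"
    and "\<And>\<mu>. (\<And>b. set_pmf (\<mu> b) \<subseteq> preimg g b) \<Longrightarrow> \<exists>t. computes m g t \<and> chi_val m \<mu> t \<le> ennreal (2 * d)"
  shows "rand_query_cplx m g \<le> 16 * q * q"
proof -
  have "\<exists>P. set_pmf P \<subseteq> {t. valid_tree m t \<and> height t \<le> 16 * q * q} \<and>
      (\<forall>x\<in>cube m. measure_pmf.prob P {t. (x, eval_tree t x) \<notin> g} \<le> 1 / 3)"
    by (rule multiplicative_weights[OF finite_cube]) (use distributional_tree[OF assms] in blast)
  then obtain P where P: "\<And>t. t \<in> set_pmf P \<Longrightarrow> valid_tree m t \<and> height t \<le> 16 * q * q"
    "\<And>x. x \<in> cube m \<Longrightarrow> measure_pmf.prob P {t. (x, eval_tree t x) \<notin> g} \<le> 1 / 3" by blast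
  have "2 / 3 \<le> measure_pmf.prob P {t. (x, eval_tree t x) \<in> g}" if "x \<in> cube m" for x
    using P(2)[OF that] measure_pmf.prob_compl[of "{t. (x, eval_tree t x) \<notin> g}" P]
    by (simp add: Compl_eq_Diff_UNIV[symmetric] Collect_neg_eq[symmetric])
  then show ?thesis
    unfolding rand_query_cplx_def
    by (intro Least_le exI[of _ P]) (use P(1) num_queries_le_height order_trans in blast)
qed

theorem theorem2:
  "\<exists>c::real. c > 0 \<and>
     (\<forall>m::nat. \<forall>g. m > 0 \<longrightarrow> partial_fn m g \<longrightarrow>
        preimg g False \<noteq> {} \<longrightarrow> preimg g True \<noteq> {} \<longrightarrow>
        ennreal (c * sqrt (real (rand_query_cplx m g))) \<le> conflict_cplx m g)"
proof (intro exI[of _ "1 / 20 :: real"] conjI allI impI)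
  fix m :: nat and g
  assume g: "partial_fn m g" and ne: "preimg g False \<noteq> {}" "preimg g True \<noteq> {}"
  have pc: "preimg g b \<subseteq> cube m" for b using g by (auto simp: partial_fn_def preimg_def)
  have "\<exists>x. x \<in> preimg g b" for b using ne by (cases b) auto
  then obtain x where x: "\<And>b. x b \<in> preimg g b" by metis
  \<comment> \<open>Point distributions, available because both preimages are nonempty, with
    \<open>q = 0\<close> in \<open>chi_val_ge\<close>. The bound 1 absorbs the rounding of
    \<open>q\<close> below.\<close>
  have "1 \<le> (INF t \<in> {t. computes m g t}. chi_val m (\<lambda>b. return_pmf (x b)) t)"
    using chi_val_ge[of m g _ "\<lambda>b. return_pmf (x b)" 0] pc x by (intro INF_greatest) auto
  also have "\<dots> \<le> conflict_cplx m g"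
    unfolding conflict_cplx_def by (rule SUP_upper) (use x in auto)
  finally have one: "1 \<le> conflict_cplx m g" .
  show "ennreal (1 / 20 * sqrt (real (rand_query_cplx m g))) \<le> conflict_cplx m g"
  proof (cases "conflict_cplx m g")
    case top
    then show ?thesis by simp
  next
    case (real d)
    then have d: "1 \<le> d" using one by simp
    \<comment> \<open>Rounding up costs at most 1, so \<open>q\<close> is at most
      \<open>5 * d\<close>; then \<open>16 * q * q\<close> is at most
      \<open>(20 * d)\<^sup>2\<close>, whence the constant 1/20.\<close>
    define q where "q = nat \<lceil>4 * d\<rceil>"
    have q: "4 * d \<le> real q" "real q \<le> 5 * d" using d by (auto simp: q_def) linarith+
    have "\<exists>t. computes m g t \<and> chi_val m \<mu> t \<le> ennreal (2 * d)"
      if "\<And>b. set_pmf (\<mu> b) \<subseteq> preimg g b" for \<mu>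
    proof -
      have "(INF t \<in> {t. computes m g t}. chi_val m \<mu> t) \<le> conflict_cplx m g"
        unfolding conflict_cplx_def by (rule SUP_upper) (use that in auto)
      \<comment> \<open>The factor 2 makes the inequality strict, so a tree exists without the
        infimum having to be attained.\<close>
      also have "\<dots> < ennreal (2 * d)" using real d by (simp add: ennreal_less_iff)
      finally show ?thesis by (auto simp: INF_less_iff intro: less_imp_le)
    qed
    then have "rand_query_cplx m g \<le> 16 * q * q" by (rule rand_query_cplx_le[OF g d q(1)])
    then have "real (rand_query_cplx m g) \<le> real (16 * q * q)" by (simp only: of_nat_le_iff)
    also have "\<dots> = 16 * (real q)\<^sup>2" by (simp add: power2_eq_square)
    also have "\<dots> \<le> 16 * (5 * d)\<^sup>2" using q by (intro mult_left_mono power_mono) auto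
    also have "\<dots> = (20 * d)\<^sup>2" by (simp add: power_mult_distrib)
    finally have "sqrt (real (rand_query_cplx m g)) \<le> 20 * d"
      using d by (intro real_le_lsqrt) auto
    then show ?thesis using real by (simp add: ennreal_leI)
  qed
qed simp

end
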